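(* Let $n,p\ge 1$ be integers and let $\mathcal{T}\subseteq\mathbb{R}^{n\times p}$ be the set of possible values of a parameter $\Theta$. Let $X$ be a random $n\times p$ matrix with columns $x_{(1)},\dots,x_{(p)}\in\mathbb{R}^n$, and let $u=(u_1,\dots,u_p)^T$ be a vector of auxiliary random variables (possibly absent). Suppose that $(X,u)$ has joint distribution $F=F_\Theta$ depending on $\Theta\in\mathcal{T}$, such that for every $\Theta\in\mathcal{T}$, with columns $\theta_{(1)},\dots,\theta_{(p)}$, one has $E_F(X)=\Theta$ and the pairs $(x_{(1)},u_1),\dots,(x_{(p)},u_p)$ are independent under $F$. Suppose there exist (measurable) shrinkage functions $g_{(j)}=g_{(j)}(x_{(j)},u_j)\in\mathbb{R}^n$, $j=1,\dots,p$, not depending on $\Theta$, such that for every $\Theta\in\mathcal{T}$ and every $j=1,\dots,p$ the entries of $x_{(j)}$ and of $g_{(j)}(x_{(j)},u_j)$ have finite second moments under $F$, and the cross-product inequality $$E_F\{(x_{(j)}-\theta_{(j)})^T g_{(j)}\}\ \ge\ E_F(g_{(j)}^T g_{(j)})\ >\ 0$$ holds. For $a\in\mathbb{R}$ let $\hat\Theta_a$ be the $n\times p$ matrix whose $j$th column is $$\hat\theta_{a,(j)} = x_{(j)}-a\,g_{(j)}(x_{(j)},u_j),\qquad j=1,\dots,p,$$ so that $\hat\Theta_0=X$. If $0<a<2/p$, then $\hat\Theta_a$ strictly dominates $\hat\Theta_0=X$ under the matrix quadratic loss function, that is, for every $\Theta\in\mathcal{T}$ the $p\times p$ matrix $$R_{\mathrm{matrix}}(\hat\Theta_0,\Theta)-R_{\mathrm{matrix}}(\hat\Theta_a,\Theta)$$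 is positive definite.
   Context: For an estimator $\hat\Theta$ (an $n\times p$ matrix-valued function of the data $X$ and, when present, of the auxiliary variables $u$) of the $n\times p$ mean matrix $\Theta$, the $p\times p$ matrix quadratic loss function is $$L_{\mathrm{matrix}}(\hat\Theta,\Theta)=(\hat\Theta-\Theta)^T(\hat\Theta-\Theta),$$ and the associated matrix risk function is $R_{\mathrm{matrix}}(\hat\Theta,\Theta)=E_F\{L_{\mathrm{matrix}}(\hat\Theta,\Theta)\}$, the entrywise expectation under the distribution $F=F_\Theta$. An estimator $\hat\Theta^{(1)}$ strictly dominates $\hat\Theta^{(2)}$ if, for all possible values of $\Theta$, the matrix $R_{\mathrm{matrix}}(\hat\Theta^{(2)},\Theta)-R_{\mathrm{matrix}}(\hat\Theta^{(1)},\Theta)$ is positive definite. *)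

theory Defs
  imports "HOL-Probability.Probability"
begin

text \<open>
  An n-by-p real matrix has type \<^typ>\<open>real^'p^'n\<close>, so \<open>CARD('n)\<close> and \<open>CARD('p)\<close> play the
  roles of \<open>n\<close> and \<open>p\<close>, both at least 1. A data point is a pair \<open>(X, u)\<close> in
  \<^typ>\<open>(real^'p^'n) \<times> (real^'p)\<close>, and \<open>F \<Theta>\<close> is its joint distribution. The case without auxiliary
  variables is obtained when \<open>u\<close> is constant.
\<close>

definition matrix_loss :: "real^'p^'n \<Rightarrow> real^'p^'n \<Rightarrow> real^'p^'p" where
  "matrix_loss est \<Theta> = transpose (est - \<Theta>) ** (est - \<Theta>)"

text \<open>
  The Bochner integral of a non-integrable entry is 0 by convention, so the risk is meaningful only
  when all entries of the loss are integrable; this is the case if the entries of the estimator have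
  finite second moments.
\<close>

definition matrix_risk ::
  "(real^'p^'n \<Rightarrow> ((real^'p^'n) \<times> (real^'p)) measure) \<Rightarrow>
   ((real^'p^'n) \<times> (real^'p) \<Rightarrow> real^'p^'n) \<Rightarrow> real^'p^'n \<Rightarrow> real^'p^'p" where
  "matrix_risk F est \<Theta> = (\<chi> i j. \<integral>\<omega>. matrix_loss (est \<omega>) \<Theta> $ i $ j \<partial>F \<Theta>)"

definition positive_definite :: "real^'p^'p \<Rightarrow> bool" where
  "positive_definite A \<longleftrightarrow> transpose A = A \<and> (\<forall>v. v \<noteq> 0 \<longrightarrow> v \<bullet> (A *v v) > 0)"

definition strictly_dominates ::
  "(real^'p^'n) set \<Rightarrow> (real^'p^'n \<Rightarrow> ((real^'p^'n) \<times> (real^'p)) measure) \<Rightarrow>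
   ((real^'p^'n) \<times> (real^'p) \<Rightarrow> real^'p^'n) \<Rightarrow> ((real^'p^'n) \<times> (real^'p) \<Rightarrow> real^'p^'n) \<Rightarrow> bool" where
  "strictly_dominates T F est1 est2 \<longleftrightarrow>
     (\<forall>\<Theta>\<in>T. positive_definite (matrix_risk F est2 \<Theta> - matrix_risk F est1 \<Theta>))"

definition shrinkage_estimator ::
  "('p \<Rightarrow> real^'n \<Rightarrow> real \<Rightarrow> real^'n) \<Rightarrow> real \<Rightarrow> (real^'p^'n) \<times> (real^'p) \<Rightarrow> real^'p^'n" where
  "shrinkage_estimator g a = (\<lambda>(X, u). \<chi> i j. (column j X - a *\<^sub>R g j (column j X) (u $ j)) $ i)"

lemma column_shrinkage_estimator:
  "column j (shrinkage_estimator g a (X, u)) = column j X - a *\<^sub>R g j (column j X) (u $ j)"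
  by (simp add: shrinkage_estimator_def column_def vec_eq_iff)

lemma shrinkage_estimator_0: "shrinkage_estimator g 0 = fst"
  by (auto simp: fun_eq_iff shrinkage_estimator_def column_def vec_eq_iff)

end

theory Submission
  imports Defs
begin

text \<open>
  Fix \<open>\<Theta>\<close>, write \<open>Y\<^sub>j\<close> for the error of the \<open>j\<close>th column of \<open>X\<close> and \<open>H\<^sub>j\<close> for the \<open>j\<close>th
  shrinkage vector, and let \<open>D\<close> be the difference of the two risk matrices. For a vector \<open>v\<close>,
  \<open>v \<bullet> D v\<close> is the drop in \<open>E \<bar>\<Sum>\<^sub>j v\<^sub>j Y\<^sub>j\<bar>\<^sup>2\<close> when each \<open>Y\<^sub>j\<close> is replaced by \<open>Y\<^sub>j - a H\<^sub>j\<close>, that is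
  \<open>2 a \<Sum>\<^sub>j \<Sum>\<^sub>k v\<^sub>j v\<^sub>k E(Y\<^sub>j \<bullet> H\<^sub>k) - a\<^sup>2 E \<bar>\<Sum>\<^sub>j v\<^sub>j H\<^sub>j\<bar>\<^sup>2\<close>.

  For \<open>j \<noteq> k\<close> the term \<open>E(Y\<^sub>j \<bullet> H\<^sub>k)\<close> vanishes, since \<open>Y\<^sub>j\<close> is centred and independent of \<open>H\<^sub>k\<close>
  (\<open>expectation_inner_indep_centred\<close>). By the cross-product inequality the remaining diagonal is at
  least \<open>2 a S\<close>, where \<open>S = \<Sum>\<^sub>j v\<^sub>j\<^sup>2 E \<bar>H\<^sub>j\<bar>\<^sup>2\<close>. In the subtracted term the moments
  \<open>E(H\<^sub>j \<bullet> H\<^sub>k)\<close> with \<open>j \<noteq> k\<close> can be nonzero, as the \<open>H\<^sub>j\<close> need not be centred; Cauchy-Schwarz over the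
  \<open>p\<close> summands (\<open>cross_moment_bound\<close>, summed over all pairs) bounds it by \<open>a\<^sup>2 p S\<close>. Hence
  \<open>v \<bullet> D v \<ge> a (2 - a p) S\<close>, which is positive for \<open>v \<noteq> 0\<close> and \<open>0 < a < 2 / p\<close>. This argument
  is \<open>gram_shrinkage_positive\<close>; the theorem supplies its hypotheses.
\<close>

section \<open>Second moments of vector-valued random variables\<close>

lemma integrable_inner_of_square_integrable:
  fixes f h :: "'a \<Rightarrow> 'b::euclidean_space"
  assumes [measurable]: "f \<in> borel_measurable M" "h \<in> borel_measurable M"
    and "integrable M (\<lambda>x. f x \<bullet> f x)" "integrable M (\<lambda>x. h x \<bullet> h x)"
  shows "integrable M (\<lambda>x. f x \<bullet> h x)"
proof (rule Bochner_Integration.integrable_bound)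
  show "integrable M (\<lambda>x. f x \<bullet> f x + h x \<bullet> h x)"
    using assms by simp
  have "\<bar>y \<bullet> z\<bar> \<le> y \<bullet> y + z \<bullet> z" for y z :: 'b
    using inner_ge_zero[of "y + z"] inner_ge_zero[of "y - z"]
      inner_ge_zero[of y] inner_ge_zero[of z]
    by (simp add: inner_simps inner_commute)
  then show "AE x in M. norm (f x \<bullet> h x) \<le> norm (f x \<bullet> f x + h x \<bullet> h x)"
    by (auto intro: order_trans)
qed measurable

lemma (in finite_measure) integrable_of_square_integrable:
  fixes f :: "'a \<Rightarrow> 'b::euclidean_space"
  assumes "f \<in> borel_measurable M" and "integrable M (\<lambda>x. f x \<bullet> f x)"
  shows "integrable M f"
proof (rule Bochner_Integration.integrable_bound)
  show "integrable M (\<lambda>x. 1 + f x \<bullet> f x)"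
    using assms by simp
  have "r \<le> 1 + r\<^sup>2" for r :: real
    using zero_le_power2[of "r - 1"] zero_le_power2[of r]
    unfolding power2_diff power_one by linarith
  then show "AE x in M. norm (f x) \<le> norm (1 + f x \<bullet> f x)"
    by (simp add: power2_norm_eq_inner[symmetric])
qed fact

text \<open>Expand \<open>0 \<le> E \<bar>c f - d h\<bar>\<^sup>2\<close>.\<close>

lemma cross_moment_bound:
  fixes f h :: "'a \<Rightarrow> 'b::euclidean_space" and c d :: real
  assumes [measurable]: "f \<in> borel_measurable M" "h \<in> borel_measurable M"
    and sq: "integrable M (\<lambda>x. f x \<bullet> f x)" "integrable M (\<lambda>x. h x \<bullet> h x)"
  shows "2 * (c * d * (\<integral>x. f x \<bullet> h x \<partial>M))
      \<le> c\<^sup>2 * (\<integral>x. f x \<bullet> f x \<partial>M) + d\<^sup>2 * (\<integral>x. h x \<bullet> h x \<partial>M)"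
proof -
  note fh = integrable_inner_of_square_integrable[OF assms]
  have "0 \<le> (\<integral>x. (c *\<^sub>R f x - d *\<^sub>R h x) \<bullet> (c *\<^sub>R f x - d *\<^sub>R h x) \<partial>M)"
    by (intro integral_nonneg_AE) simp
  also have "\<dots> = (\<integral>x. (c\<^sup>2 * (f x \<bullet> f x) + d\<^sup>2 * (h x \<bullet> h x)) - 2 * (c * d) * (f x \<bullet> h x) \<partial>M)"
    by (intro Bochner_Integration.integral_cong)
      (simp_all add: inner_simps inner_commute power2_eq_square algebra_simps)
  also have "\<dots> = c\<^sup>2 * (\<integral>x. f x \<bullet> f x \<partial>M) + d\<^sup>2 * (\<integral>x. h x \<bullet> h x \<partial>M)
      - 2 * (c * d) * (\<integral>x. f x \<bullet> h x \<partial>M)"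
    using sq fh by simp
  finally show ?thesis by simp
qed

section \<open>Independence and cross moments\<close>

lemma (in prob_space) indep_var_of_indep_vars:
  assumes indep: "indep_vars N X I" and "j \<in> I" "k \<in> I" "j \<noteq> k"
  shows "indep_var (N j) (X j) (N k) (X k)"
proof -
  have "indep_var (N j) ((\<lambda>f. f j) \<circ> (\<lambda>\<omega>. restrict (\<lambda>i. X i \<omega>) {j}))
      (N k) ((\<lambda>f. f k) \<circ> (\<lambda>\<omega>. restrict (\<lambda>i. X i \<omega>) {k}))"
    using assms by (intro indep_var_compose[OF indep_var_restrict[OF indep]]) auto
  then show ?thesis
    by (simp add: comp_def)
qed

text \<open>
  In coordinates the inner product is a sum of products of independent real variables, and each
  expectation factors with one factor \<open>0\<close>.
\<close>

lemma (in prob_space) expectation_inner_indep_centred: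
  fixes Y H :: "'a \<Rightarrow> 'b::euclidean_space"
  assumes indep: "indep_var borel Y borel H"
    and Y: "integrable M Y" and H: "integrable M H"
    and centred: "expectation Y = 0"
  shows "expectation (\<lambda>x. Y x \<bullet> H x) = 0"
proof -
  have ind: "indep_var borel (\<lambda>x. Y x \<bullet> b) borel (\<lambda>x. H x \<bullet> b)" for b
    using indep_var_compose[OF indep, of "\<lambda>y. y \<bullet> b" borel "\<lambda>y. y \<bullet> b" borel]
    by (simp add: comp_def)
  have Yb: "integrable M (\<lambda>x. Y x \<bullet> b)" and Hb: "integrable M (\<lambda>x. H x \<bullet> b)" for b
    using Y H by (auto intro: integrable_inner_left)
  have "expectation (\<lambda>x. Y x \<bullet> H x) = expectation (\<lambda>x. \<Sum>b\<in>Basis. (Y x \<bullet> b) * (H x \<bullet> b))"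
    by (simp add: euclidean_inner[symmetric])
  also have "\<dots> = (\<Sum>b\<in>Basis. expectation (\<lambda>x. (Y x \<bullet> b) * (H x \<bullet> b)))"
    by (intro Bochner_Integration.integral_sum indep_var_integrable ind Yb Hb)
  also have "\<dots> = (\<Sum>b\<in>Basis. expectation (\<lambda>x. Y x \<bullet> b) * expectation (\<lambda>x. H x \<bullet> b))"
    by (intro sum.cong refl indep_var_lebesgue_integral ind Yb Hb)
  also have "\<dots> = 0"
    using Y centred by (simp add: integral_inner_left)
  finally show ?thesis .
qed

section \<open>Shrinking the columns lowers the Gram matrix of the errors\<close>

text \<open>
  This is the whole inequality with the statistical model stripped off: independence and unbiasedness
  enter only through the vanishing of the off-diagonal cross moments. The conclusion is written as a
  double sum because the risk matrix is defined by its entries.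
\<close>

lemma gram_shrinkage_positive:
  fixes Y H :: "'p::finite \<Rightarrow> 'a \<Rightarrow> 'b::euclidean_space" and v :: "real^'p" and a :: real
  assumes mY: "\<And>j. Y j \<in> borel_measurable M" and mH: "\<And>j. H j \<in> borel_measurable M"
    and sqY: "\<And>j. integrable M (\<lambda>x. Y j x \<bullet> Y j x)"
    and sqH: "\<And>j. integrable M (\<lambda>x. H j x \<bullet> H j x)"
    and off_diagonal: "\<And>j k. j \<noteq> k \<Longrightarrow> (\<integral>x. Y j x \<bullet> H k x \<partial>M) = 0"
    and diagonal: "\<And>j. (\<integral>x. Y j x \<bullet> H j x \<partial>M) \<ge> (\<integral>x. H j x \<bullet> H j x \<partial>M)"
    and pos: "\<And>j. (\<integral>x. H j x \<bullet> H j x \<partial>M) > 0"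
    and a: "0 < a" "a < 2 / real CARD('p)" and v: "v \<noteq> 0"
  shows "0 < (\<Sum>j\<in>UNIV. \<Sum>k\<in>UNIV. v $ j * v $ k *
    ((\<integral>x. Y j x \<bullet> Y k x \<partial>M) - (\<integral>x. (Y j x - a *\<^sub>R H j x) \<bullet> (Y k x - a *\<^sub>R H k x) \<partial>M)))"
    (is "0 < ?Q")
proof -
  define B C where "B j k = (\<integral>x. Y j x \<bullet> H k x \<partial>M)" and "C j k = (\<integral>x. H j x \<bullet> H k x \<partial>M)" for j k
  define S where "S = (\<Sum>j\<in>UNIV. (v $ j)\<^sup>2 * C j j)"
  have diff: "(\<integral>x. Y j x \<bullet> Y k x \<partial>M) - (\<integral>x. (Y j x - a *\<^sub>R H j x) \<bullet> (Y k x - a *\<^sub>R H k x) \<partial>M)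
      = a * (B j k + B k j) - a\<^sup>2 * C j k" for j k
  proof -
    \<comment> \<open>Every cross moment must be integrable before the integral of the expansion can be split.\<close>
    note int = integrable_inner_of_square_integrable[OF mY mY sqY sqY, of j k]
      integrable_inner_of_square_integrable[OF mY mH sqY sqH]
      integrable_inner_of_square_integrable[OF mH mH sqH sqH, of j k]
    have "(\<integral>x. (Y j x - a *\<^sub>R H j x) \<bullet> (Y k x - a *\<^sub>R H k x) \<partial>M)
        = (\<integral>x. Y j x \<bullet> Y k x - (a * (Y j x \<bullet> H k x) + a * (Y k x \<bullet> H j x))
            + a\<^sup>2 * (H j x \<bullet> H k x) \<partial>M)"
      by (intro Bochner_Integration.integral_cong)
        (simp_all add: inner_simps inner_commute power2_eq_square algebra_simps)
    also have "\<dots> = (\<integral>x. Y j x \<bullet> Y k x \<partial>M) - (a * B j k + a * B k j) + a\<^sup>2 * C j k"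
      using int by (simp add: B_def C_def)
    finally show ?thesis by (simp add: algebra_simps)
  qed
  have B_diag: "(\<Sum>j\<in>UNIV. \<Sum>k\<in>UNIV. v $ j * v $ k * B j k) = (\<Sum>j\<in>UNIV. (v $ j)\<^sup>2 * B j j)"
  proof (intro sum.cong refl)
    fix j
    have "(\<Sum>k\<in>UNIV. v $ j * v $ k * B j k) = (\<Sum>k\<in>UNIV. if k = j then (v $ j)\<^sup>2 * B j j else 0)"
      by (intro sum.cong) (auto simp: B_def off_diagonal power2_eq_square)
    then show "(\<Sum>k\<in>UNIV. v $ j * v $ k * B j k) = (v $ j)\<^sup>2 * B j j"
      by simp
  qed
  have B_swap: "(\<Sum>j\<in>UNIV. \<Sum>k\<in>UNIV. v $ j * v $ k * B k j)
      = (\<Sum>j\<in>UNIV. \<Sum>k\<in>UNIV. v $ j * v $ k * B j k)"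
    by (subst sum.swap) (simp add: mult.commute)
  have B_lower: "S \<le> (\<Sum>j\<in>UNIV. (v $ j)\<^sup>2 * B j j)"
    unfolding S_def using diagonal by (intro sum_mono mult_left_mono) (auto simp: B_def C_def)
  \<comment> \<open>Pairwise bounds suffice: each square occurs \<open>2 p\<close> times among the \<open>p\<^sup>2\<close> ordered pairs.\<close>
  have "2 * (\<Sum>j\<in>UNIV. \<Sum>k\<in>UNIV. v $ j * v $ k * C j k)
      \<le> (\<Sum>j\<in>UNIV. \<Sum>k\<in>UNIV. (v $ j)\<^sup>2 * C j j + (v $ k)\<^sup>2 * C k k)"
    unfolding sum_distrib_left C_def
    by (intro sum_mono cross_moment_bound mH sqH)
  also have "\<dots> = 2 * (real CARD('p) * S)"
    by (simp add: sum.distrib S_def sum_distrib_left)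
  finally have C_upper: "(\<Sum>j\<in>UNIV. \<Sum>k\<in>UNIV. v $ j * v $ k * C j k) \<le> real CARD('p) * S"
    by simp
  have "0 < S"
  proof -
    obtain j where "v $ j \<noteq> 0"
      using v by (auto simp: vec_eq_iff)
    then have "0 < (v $ j)\<^sup>2 * C j j"
      using pos by (simp add: C_def)
    moreover have "0 \<le> (v $ k)\<^sup>2 * C k k" for k
      using pos[of k] by (simp add: C_def)
    ultimately show ?thesis
      unfolding S_def by (intro sum_pos2[of UNIV j]) auto
  qed
  moreover have "0 < 2 - a * real CARD('p)"
    using a by (simp add: field_simps)
  ultimately have "0 < a * ((2 - a * real CARD('p)) * S)"
    using a by simp
  also have "\<dots> = 2 * a * S - a\<^sup>2 * (real CARD('p) * S)"
    by (simp add: algebra_simps power2_eq_square)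
  also have "\<dots> \<le> 2 * a * (\<Sum>j\<in>UNIV. (v $ j)\<^sup>2 * B j j)
      - a\<^sup>2 * (\<Sum>j\<in>UNIV. \<Sum>k\<in>UNIV. v $ j * v $ k * C j k)"
    using B_lower C_upper a by (intro diff_mono mult_left_mono) auto
  also have "\<dots> = a * ((\<Sum>j\<in>UNIV. \<Sum>k\<in>UNIV. v $ j * v $ k * B j k)
      + (\<Sum>j\<in>UNIV. \<Sum>k\<in>UNIV. v $ j * v $ k * B k j))
      - a\<^sup>2 * (\<Sum>j\<in>UNIV. \<Sum>k\<in>UNIV. v $ j * v $ k * C j k)"
    unfolding B_swap B_diag by simp
  also have "\<dots> = ?Q"
    unfolding diff
    by (simp add: sum_distrib_left sum.distrib[symmetric] sum_subtractf[symmetric] algebra_simps)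
  finally show ?thesis .
qed

section \<open>The matrix risk\<close>

lemma inner_matrix_vector_mult:
  fixes A :: "real^'p^'p"
  shows "v \<bullet> (A *v v) = (\<Sum>j\<in>UNIV. \<Sum>k\<in>UNIV. v $ j * v $ k * A $ j $ k)"
  by (simp add: inner_vec_def matrix_vector_mult_def sum_distrib_left algebra_simps)

lemma matrix_loss_component:
  "matrix_loss E \<Theta> $ j $ k = (column j E - column j \<Theta>) \<bullet> (column k E - column k \<Theta>)"
  by (simp add: matrix_loss_def matrix_matrix_mult_def transpose_def inner_vec_def column_def)

lemma transpose_matrix_risk: "transpose (matrix_risk F est \<Theta>) = matrix_risk F est \<Theta>"
  by (simp add: matrix_risk_def transpose_def vec_eq_iff matrix_loss_component inner_commute)

theorem theorem2:
  fixes T :: "(real^'p^'n) set"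
    and F :: "real^'p^'n \<Rightarrow> ((real^'p^'n) \<times> (real^'p)) measure"
    and g :: "'p \<Rightarrow> real^'n \<Rightarrow> real \<Rightarrow> real^'n"
    and a :: real
  assumes prob: "\<And>\<Theta>. \<Theta> \<in> T \<Longrightarrow> prob_space (F \<Theta>)"
    and sets_F: "\<And>\<Theta>. \<Theta> \<in> T \<Longrightarrow> sets (F \<Theta>) = sets borel"
    and g_measurable: "\<And>j. (\<lambda>(x, s). g j x s) \<in> borel_measurable borel"
    and X_second_moment:
      "\<And>\<Theta> j i. \<Theta> \<in> T \<Longrightarrow> integrable (F \<Theta>) (\<lambda>(X, u). (column j X $ i)\<^sup>2)"
    and g_second_moment:
      "\<And>\<Theta> j i. \<Theta> \<in> T \<Longrightarrow> integrable (F \<Theta>) (\<lambda>(X, u). (g j (column j X) (u $ j) $ i)\<^sup>2)"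
    and mean: "\<And>\<Theta>. \<Theta> \<in> T \<Longrightarrow> (\<integral>(X, u). X \<partial>F \<Theta>) = \<Theta>"
    and indep: "\<And>\<Theta>. \<Theta> \<in> T \<Longrightarrow>
      prob_space.indep_vars (F \<Theta>) (\<lambda>j. borel) (\<lambda>j (X, u). (column j X, u $ j)) UNIV"
    and cross_product: "\<And>\<Theta> j. \<Theta> \<in> T \<Longrightarrow>
      (\<integral>(X, u). (column j X - column j \<Theta>) \<bullet> g j (column j X) (u $ j) \<partial>F \<Theta>)
        \<ge> (\<integral>(X, u). g j (column j X) (u $ j) \<bullet> g j (column j X) (u $ j) \<partial>F \<Theta>)"
    and g_nonzero: "\<And>\<Theta> j. \<Theta> \<in> T \<Longrightarrow>
      (\<integral>(X, u). g j (column j X) (u $ j) \<bullet> g j (column j X) (u $ j) \<partial>F \<Theta>) > 0"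
    and a_bounds: "0 < a" "a < 2 / real CARD('p)"
  shows "strictly_dominates T F (shrinkage_estimator g a) (shrinkage_estimator g 0)"
  unfolding strictly_dominates_def
proof
  fix \<Theta> assume \<Theta>: "\<Theta> \<in> T"
  interpret prob_space "F \<Theta>" using prob[OF \<Theta>] .
  define Z where "Z j \<omega> = (column j (fst \<omega>), snd \<omega> $ j)" for j and \<omega> :: "(real^'p^'n) \<times> (real^'p)"
  define Y where "Y j \<omega> = column j (fst \<omega>) - column j \<Theta>" for j and \<omega> :: "(real^'p^'n) \<times> (real^'p)"
  define H where "H j \<omega> = g j (column j (fst \<omega>)) (snd \<omega> $ j)" for j and \<omega> :: "(real^'p^'n) \<times> (real^'p)"
  have Z_indep: "indep_vars (\<lambda>j. borel) Z UNIV"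
    using indep[OF \<Theta>] by (simp add: Z_def[abs_def] case_prod_beta')
  have mZ: "Z j \<in> borel_measurable (F \<Theta>)" for j
    using Z_indep by (auto simp: indep_vars_def)
  \<comment> \<open>\<open>Y j\<close> and \<open>H j\<close> are functions of \<open>Z j\<close> alone and inherit measurability and independence.\<close>
  have Y_Z: "Y j = (\<lambda>z. fst z - column j \<Theta>) \<circ> Z j" for j
    by (auto simp: Y_def Z_def)
  have H_Z: "H j = (\<lambda>z. g j (fst z) (snd z)) \<circ> Z j" for j
    by (auto simp: H_def Z_def)
  have fst_borel: "(\<lambda>z::(real^'n) \<times> real. fst z - c) \<in> borel_measurable borel" for c
    by (intro borel_measurable_continuous_onI continuous_intros)
  have g_borel: "(\<lambda>z. g j (fst z) (snd z)) \<in> borel_measurable borel" for j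
    using g_measurable[of j] by (simp add: case_prod_beta')
  have mY: "Y j \<in> borel_measurable (F \<Theta>)" and mH: "H j \<in> borel_measurable (F \<Theta>)" for j
    unfolding Y_Z H_Z by (rule measurable_comp[OF mZ fst_borel] measurable_comp[OF mZ g_borel])+
  have col: "integrable (F \<Theta>) (\<lambda>\<omega>. column j (fst \<omega>) \<bullet> column j (fst \<omega>))" for j
    unfolding inner_vec_def using X_second_moment[OF \<Theta>]
    by (intro Bochner_Integration.integrable_sum) (simp add: case_prod_beta' power2_eq_square)
  have sqH: "integrable (F \<Theta>) (\<lambda>\<omega>. H j \<omega> \<bullet> H j \<omega>)" for j
    unfolding inner_vec_def H_def using g_second_moment[OF \<Theta>]
    by (intro Bochner_Integration.integrable_sum) (simp add: case_prod_beta' power2_eq_square)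
  have int_col: "integrable (F \<Theta>) (\<lambda>\<omega>. column j (fst \<omega>))" for j
  proof (rule integrable_of_square_integrable[OF _ col])
    show "(\<lambda>\<omega>. column j (fst \<omega>)) \<in> borel_measurable (F \<Theta>)"
      using measurable_comp[OF mZ[of j] fst_borel[of 0]] by (simp add: Z_def comp_def)
  qed
  have intY: "integrable (F \<Theta>) (Y j)" for j
    unfolding Y_def using int_col by simp
  have intH: "integrable (F \<Theta>) (H j)" for j
    by (rule integrable_of_square_integrable[OF mH sqH])
  have sqY: "integrable (F \<Theta>) (\<lambda>\<omega>. Y j \<omega> \<bullet> Y j \<omega>)" for j
    unfolding Y_def inner_diff_left inner_diff_right using col int_col by simp
  \<comment> \<open>Without integrability of the whole matrix, its Bochner integral would be \<open>0\<close> by convention and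
      would not determine the means of the columns.\<close>
  have int_X: "integrable (F \<Theta>) fst"
  proof (rule integrable_of_square_integrable)
    show "fst \<in> borel_measurable (F \<Theta>)"
      using sets_F[OF \<Theta>] by (simp cong: measurable_cong_sets add: borel_prod[symmetric])
    have "fst \<omega> \<bullet> fst \<omega> = (\<Sum>j\<in>UNIV. column j (fst \<omega>) \<bullet> column j (fst \<omega>))"
      for \<omega> :: "(real^'p^'n) \<times> (real^'p)"
      unfolding inner_vec_def column_def by (subst sum.swap) simp
    then show "integrable (F \<Theta>) (\<lambda>\<omega>. fst \<omega> \<bullet> fst \<omega>)"
      using col by simp
  qed
  have column_linear: "bounded_linear (column j :: real^'p^'n \<Rightarrow> real^'n)" for j
    by (intro linear_linear[THEN iffD2] linearI) (simp_all add: column_def vec_eq_iff)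
  have centred: "expectation (Y j) = 0" for j
  proof -
    have "expectation (\<lambda>\<omega>. column j (fst \<omega>)) = column j (expectation fst)"
      by (rule integral_bounded_linear[OF column_linear int_X])
    also have "expectation fst = \<Theta>"
      using mean[OF \<Theta>] by (simp add: case_prod_beta')
    finally show ?thesis
      unfolding Y_def using int_col by (simp add: prob_space)
  qed
  have off_diagonal: "expectation (\<lambda>\<omega>. Y j \<omega> \<bullet> H k \<omega>) = 0" if "j \<noteq> k" for j k
  proof (rule expectation_inner_indep_centred[OF _ intY intH centred])
    have "indep_var borel (Z j) borel (Z k)"
      by (rule indep_var_of_indep_vars[OF Z_indep _ _ that]) simp_all
    then show "indep_var borel (Y j) borel (H k)"
      unfolding Y_Z H_Z by (rule indep_var_compose[OF _ fst_borel g_borel])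
  qed
  have diagonal: "expectation (\<lambda>\<omega>. Y j \<omega> \<bullet> H j \<omega>) \<ge> expectation (\<lambda>\<omega>. H j \<omega> \<bullet> H j \<omega>)" for j
    using cross_product[OF \<Theta>, of j] by (simp add: Y_def H_def case_prod_beta')
  have pos: "expectation (\<lambda>\<omega>. H j \<omega> \<bullet> H j \<omega>) > 0" for j
    using g_nonzero[OF \<Theta>, of j] by (simp add: H_def case_prod_beta')
  have column_error: "column j (shrinkage_estimator g b \<omega>) - column j \<Theta> = Y j \<omega> - b *\<^sub>R H j \<omega>" for b j \<omega>
    by (cases \<omega>) (simp add: column_shrinkage_estimator Y_def H_def)
  \<comment> \<open>Stated for every \<open>b\<close>, so that \<open>b = 0\<close> gives the risk of the unshrunk estimator.\<close>
  have risk: "matrix_risk F (shrinkage_estimator g b) \<Theta> $ j $ k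
      = expectation (\<lambda>\<omega>. (Y j \<omega> - b *\<^sub>R H j \<omega>) \<bullet> (Y k \<omega> - b *\<^sub>R H k \<omega>))" for b j k
    by (simp add: matrix_risk_def matrix_loss_component column_error)
  let ?D = "matrix_risk F (shrinkage_estimator g 0) \<Theta> - matrix_risk F (shrinkage_estimator g a) \<Theta>"
  have "v \<bullet> (?D *v v) > 0" if "v \<noteq> 0" for v
    using gram_shrinkage_positive[OF mY mH sqY sqH off_diagonal diagonal pos a_bounds that]
    by (simp add: inner_matrix_vector_mult risk)
  moreover have "transpose ?D = ?D"
    using transpose_matrix_risk[of F "shrinkage_estimator g 0" \<Theta>]
      transpose_matrix_risk[of F "shrinkage_estimator g a" \<Theta>]
    by (simp add: transpose_def vec_eq_iff)
  ultimately show "positive_definite ?D"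
    by (simp add: positive_definite_def)
qed

end
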